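(* Let $X\ge 1$ be an integer, let $\mathbf F_0,\mathbf F_1\in\mathbb R^{X\times X}$ be Markov transition matrices, and let $\tilde{\mathbf F}=\mathbf F_1-\mathbf F_0$ with $r=\mathrm{rank}(\tilde{\mathbf F})$. Let $\tilde{\mathbf F}=\mathbf U_{\tilde F}\mathbf S_{\tilde F}\mathbf V_{\tilde F}^\top$ be a singular value decomposition with the nonzero singular values listed first, and partition $\mathbf S_0:=\mathbf V_{\tilde F}^\top\mathbf F_0\mathbf V_{\tilde F}$ as $$\mathbf S_0=\begin{bmatrix}\mathbf S_{0,00}&\mathbf S_{0,01}\\ \mathbf S_{0,10}&\mathbf S_{0,11}\end{bmatrix},$$ where $\mathbf S_{0,00}$ is $r\times r$, $\mathbf S_{0,01}$ is $r\times(X-r)$, $\mathbf S_{0,10}$ is $(X-r)\times r$ and $\mathbf S_{0,11}$ is $(X-r)\times(X-r)$. If $$\mathbf S_{0,01}\,\mathbf S_{0,11}\,(\mathbf I-\mathbf S_{0,01}^+\mathbf S_{0,01})=0,$$ then the model exhibits 2-period finite dependence, i.e. $\tilde{\mathbf F}^{(2)}=0$, where, with $\mathcal P_{\tilde F}=\mathbf I-\tilde{\mathbf F}^+\tilde{\mathbf F}$, $$\tilde{\mathbf F}^{(2)}=\tilde{\mathbf F}\mathbf F_0\mathbf F_0\mathcal P_{\tilde F}\Big(\mathbf I-(\tilde{\mathbf F}\mathbf F_0\mathcal P_{\tilde F})^+(\tilde{\mathbf F}\mathbf F_0\mathcal P_{\tilde F})\Big).$$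
   Context: A Markov transition matrix is a square matrix with nonnegative entries whose rows each sum to $1$. $\mathbf A^+$ denotes the Moore–Penrose inverse of $\mathbf A$, and $\mathbf I$ an identity matrix of conforming size. In the singular value decomposition, $\mathbf U_{\tilde F},\mathbf V_{\tilde F}$ are $X\times X$ orthogonal matrices and $$\mathbf S_{\tilde F}=\begin{bmatrix}\mathbf S_{\tilde F,00}&0\\0&0\end{bmatrix}$$ with $\mathbf S_{\tilde F,00}$ the $r\times r$ diagonal matrix of nonzero singular values. $\mathcal P_{\tilde F}$ is the orthogonal projector onto the null space of $\tilde{\mathbf F}$. Setting: a binary dynamic discrete choice model (actions $0,1$) with $X$ observed states, in which $\mathbf F_d$ is the state transition matrix (rows: current state; columns: next state) under action $d$. Decision weights at $t+1$ and $t+2$ (each depending on the state at that date and on the initial state $x_t$) are encoded, after multiplication by the corresponding difference in state probabilities between initial actions $1$ and $0$, in $X\times X$ matrices $\check{\mathbf w}_{t+1},\check{\mathbf w}_{t+2}$ with rows indexed by $x_t$. The difference between the weighted three-step transitions starting from action $1$ and from action $0$ is $$\check{\mathbf w}_{t+2}\tilde{\mathbf F}+\check{\mathbf w}_{t+1}\tilde{\mathbf F}\mathbf F_0+\tilde{\mathbf F}\mathbf F_0^2 .$$ The matrix $\tilde{\mathbf F}^{(2)}$ is the value of this expression at the choice $$\check{\mathbf w}_{t+2}=-(\check{\mathbf w}_{t+1}\tilde{\mathbf F}+\tilde{\mathbf F}\mathbf F_0)\mathbf F_0\tilde{\mathbf F}^+,\qquad \check{\mathbf w}_{t+1}=-\tilde{\mathbf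 F}\mathbf F_0^2\mathcal P_{\tilde F}(\tilde{\mathbf F}\mathbf F_0\mathcal P_{\tilde F})^+,$$ and 2-period finite dependence is understood as the matrix $\tilde{\mathbf F}^{(2)}$ being zero. *)

theory Defs
  imports
    "Jordan_Normal_Form.Matrix"
    "Jordan_Normal_Form.Matrix_Kernel"
    "Jordan_Normal_Form.DL_Rank"
begin

definition markov_mat :: "nat \<Rightarrow> real mat \<Rightarrow> bool" where
  "markov_mat n P \<longleftrightarrow>
     P \<in> carrier_mat n n \<and>
     (\<forall>i<n. \<forall>j<n. 0 \<le> P $$ (i, j)) \<and>
     (\<forall>i<n. (\<Sum>j<n. P $$ (i, j)) = 1)"

(* The library's orthogonal_mat only asks for pairwise orthogonal nonzero columns. *)
definition orthonormal_mat :: "nat \<Rightarrow> real mat \<Rightarrow> bool" where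
  "orthonormal_mat n U \<longleftrightarrow>
     U \<in> carrier_mat n n \<and>
     transpose_mat U * U = 1\<^sub>m n \<and> U * transpose_mat U = 1\<^sub>m n"

(* Only the r nonzero singular values are stored, in D; they are not required to be sorted. *)
definition is_svd :: "nat \<Rightarrow> nat \<Rightarrow> real mat \<Rightarrow> real mat \<Rightarrow> real mat \<Rightarrow> real mat \<Rightarrow> bool" where
  "is_svd n r A U D V \<longleftrightarrow>
     r \<le> n \<and> orthonormal_mat n U \<and> orthonormal_mat n V \<and>
     D \<in> carrier_mat r r \<and> diagonal_mat D \<and> (\<forall>i<r. 0 < D $$ (i, i)) \<and>
     A = U * four_block_mat D (0\<^sub>m r (n - r)) (0\<^sub>m (n - r) r) (0\<^sub>m (n - r) (n - r))
           * transpose_mat V"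

(* Penrose's four conditions for B to be the Moore-Penrose inverse of A. *)
definition is_pinv :: "real mat \<Rightarrow> real mat \<Rightarrow> bool" where
  "is_pinv A B \<longleftrightarrow>
     B \<in> carrier_mat (dim_col A) (dim_row A) \<and>
     A * B * A = A \<and> B * A * B = B \<and>
     transpose_mat (A * B) = A * B \<and> transpose_mat (B * A) = B * A"

lemma is_pinv_unique:
  assumes B: "is_pinv A B" and C: "is_pinv A C"
  shows "B = C"
proof -
  define m n where "m = dim_row A" and "n = dim_col A"
  have cA: "A \<in> carrier_mat m n" by (simp add: m_def n_def)
  have cB: "B \<in> carrier_mat n m" and cC: "C \<in> carrier_mat n m"
    using B C by (simp_all add: is_pinv_def m_def n_def)
  have b: "A * B * A = A" "B * A * B = B"
      "transpose_mat (A * B) = A * B" "transpose_mat (B * A) = B * A"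
    using B by (simp_all add: is_pinv_def)
  have c: "A * C * A = A" "C * A * C = C"
      "transpose_mat (A * C) = A * C" "transpose_mat (C * A) = C * A"
    using C by (simp_all add: is_pinv_def)
  have cAB: "A * B \<in> carrier_mat m m" and cAC: "A * C \<in> carrier_mat m m"
    and cBA: "B * A \<in> carrier_mat n n" and cCA: "C * A \<in> carrier_mat n n"
    using cA cB cC by auto
  have 1: "(A * C) * (A * B) = A * B"
    using assoc_mult_mat[OF cAC cA cB] c(1) by simp
  have "transpose_mat ((A * C) * (A * B)) = (A * B) * (A * C)"
    using transpose_mult[OF cAC cAB] b(3) c(3) by simp
  also have "(A * B) * (A * C) = A * C"
    using assoc_mult_mat[OF cAB cA cC] b(1) by simp
  finally have AB: "A * B = A * C" using 1 b(3) by simp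
  have 2: "(B * A) * (C * A) = B * A"
    using assoc_mult_mat[OF cB cA cCA] assoc_mult_mat[OF cA cC cA] c(1) by simp
  have "transpose_mat ((B * A) * (C * A)) = (C * A) * (B * A)"
    using transpose_mult[OF cBA cCA] b(4) c(4) by simp
  also have "(C * A) * (B * A) = C * A"
    using assoc_mult_mat[OF cC cA cBA] assoc_mult_mat[OF cA cB cA] b(1) by simp
  finally have BA: "B * A = C * A" using 2 b(4) by simp
  have "B = C * A * B" using b(2) BA by simp
  also have "\<dots> = C * (A * C)" using assoc_mult_mat[OF cC cA cB] AB by simp
  also have "\<dots> = C" using assoc_mult_mat[OF cC cA cC] c(2) by simp
  finally show ?thesis .
qed

definition pinv :: "real mat \<Rightarrow> real mat" where
  "pinv A = (THE B. is_pinv A B)"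

lemma pinv_eqI: "is_pinv A B \<Longrightarrow> pinv A = B"
  unfolding pinv_def using is_pinv_unique by blast

definition null_proj :: "real mat \<Rightarrow> real mat" where
  "null_proj A = 1\<^sub>m (dim_col A) - pinv A * A"

(* null_proj is symmetric and idempotent with range the null space, that is, the orthogonal
   projector onto the null space. *)
lemma null_proj_is_orthogonal_projector:
  assumes "is_pinv A B"
  shows "transpose_mat (null_proj A) = null_proj A"
    and "null_proj A * null_proj A = null_proj A"
    and "(\<lambda>v. null_proj A *\<^sub>v v) ` carrier_vec (dim_col A) = mat_kernel A"
proof -
  define m n where "m = dim_row A" and "n = dim_col A"
  have cA: "A \<in> carrier_mat m n" by (simp add: m_def n_def)
  have cB: "B \<in> carrier_mat n m"
    using assms by (simp add: is_pinv_def m_def n_def)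
  have b: "A * B * A = A" "transpose_mat (B * A) = B * A"
    using assms by (simp_all add: is_pinv_def)
  define Q where "Q = B * A"
  have cQ: "Q \<in> carrier_mat n n" using cA cB by (simp add: Q_def)
  have P: "null_proj A = 1\<^sub>m n - Q"
    by (simp add: null_proj_def pinv_eqI[OF assms] n_def Q_def)
  have Z: "1\<^sub>m n - Q - 0\<^sub>m n n = 1\<^sub>m n - Q"
    using cQ by (intro eq_matI) auto
  have cP: "1\<^sub>m n - Q \<in> carrier_mat n n" using cQ by (rule minus_carrier_mat)
  show "transpose_mat (null_proj A) = null_proj A"
    using transpose_minus[OF one_carrier_mat cQ] b(2) by (simp add: P Q_def)
  have AQ: "A * Q = A"
    using assoc_mult_mat[OF cA cB cA] b(1) by (simp add: Q_def)
  have AP: "A * (1\<^sub>m n - Q) = 0\<^sub>m m n"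
    using mult_minus_distrib_mat[OF cA one_carrier_mat cQ] cA AQ by simp
  have "Q * (1\<^sub>m n - Q) = 0\<^sub>m n n"
    using assoc_mult_mat[OF cB cA cP] AP cB by (simp add: Q_def)
  then show "null_proj A * null_proj A = null_proj A"
    using minus_mult_distrib_mat[OF one_carrier_mat cQ cP] cP cQ by (simp add: P Z)
  show "(\<lambda>v. null_proj A *\<^sub>v v) ` carrier_vec (dim_col A) = mat_kernel A"
  proof (intro equalityI subsetI)
    fix w assume "w \<in> (\<lambda>v. null_proj A *\<^sub>v v) ` carrier_vec (dim_col A)"
    then obtain v where v: "v \<in> carrier_vec n" and w: "w = (1\<^sub>m n - Q) *\<^sub>v v"
      by (auto simp: P n_def)
    have "0\<^sub>m m n *\<^sub>v v = 0\<^sub>v m" using v by (intro eq_vecI) auto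
    then have "A *\<^sub>v w = 0\<^sub>v m"
      using assoc_mult_mat_vec[OF cA cP v] AP by (simp add: w)
    then show "w \<in> mat_kernel A"
      using mat_kernelI[OF cA] cP v w by (metis mult_mat_vec_carrier)
  next
    fix w assume "w \<in> mat_kernel A"
    then have cw: "w \<in> carrier_vec n" and Aw: "A *\<^sub>v w = 0\<^sub>v m"
      by (auto simp: mat_kernel_def n_def m_def)
    have "B *\<^sub>v 0\<^sub>v m = 0\<^sub>v n" using cB by (intro eq_vecI) auto
    then have "Q *\<^sub>v w = 0\<^sub>v n"
      using assoc_mult_mat_vec[OF cB cA cw] Aw by (simp add: Q_def)
    then have "(1\<^sub>m n - Q) *\<^sub>v w = w"
      using minus_mult_distrib_mat_vec[OF one_carrier_mat cQ cw] cw by auto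
    then show "w \<in> (\<lambda>v. null_proj A *\<^sub>v v) ` carrier_vec (dim_col A)"
      using cw unfolding P n_def[symmetric] by (metis imageI)
  qed
qed

(* In the following, Ft is F1 - F0, and w1, w2 are the weight matrices at t + 1 and t + 2. *)

definition transition_diff2 :: "real mat \<Rightarrow> real mat \<Rightarrow> real mat \<Rightarrow> real mat \<Rightarrow> real mat" where
  "transition_diff2 Ft F0 w1 w2 = w2 * Ft + w1 * Ft * F0 + Ft * (F0 * F0)"

definition weight1 :: "real mat \<Rightarrow> real mat \<Rightarrow> real mat" where
  "weight1 Ft F0 = - (Ft * (F0 * F0) * null_proj Ft * pinv (Ft * F0 * null_proj Ft))"

definition weight2 :: "real mat \<Rightarrow> real mat \<Rightarrow> real mat \<Rightarrow> real mat" where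
  "weight2 Ft F0 w1 = - ((w1 * Ft + Ft * F0) * F0 * pinv Ft)"

definition Ftilde2 :: "real mat \<Rightarrow> real mat \<Rightarrow> real mat" where
  "Ftilde2 F0 F1 =
     (let Ft = F1 - F0; w1 = weight1 Ft F0; w2 = weight2 Ft F0 w1
      in transition_diff2 Ft F0 w1 w2)"

definition two_period_finite_dependence :: "nat \<Rightarrow> real mat \<Rightarrow> real mat \<Rightarrow> bool" where
  "two_period_finite_dependence X F0 F1 \<longleftrightarrow> Ftilde2 F0 F1 = 0\<^sub>m X X"

end

theory Submission
  imports Defs
begin

text \<open>
  The choice of weights telescopes \<open>Ftilde2 F0 F1\<close> to \<open>Ft F0\<^sup>2 Y\<close> with
  \<open>Y = P (I - M\<^sup>+ M)\<close>. Every column \<open>y\<close> of \<open>Y\<close> satisfies \<open>Ft y = 0\<close> and \<open>Ft F0 y = 0\<close>.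
  In the coordinates \<open>V\<^sup>T y\<close> the null space of \<open>Ft\<close> consists of the vectors whose first \<open>r\<close>
  entries vanish, so these equations say \<open>V\<^sup>T y = (0, z)\<close> and \<open>S01 z = 0\<close>. Hence
  \<open>z = (I - S01\<^sup>+ S01) z\<close>, the hypothesis yields \<open>S01 S11 z = 0\<close>, and this is
  \<open>Ft F0\<^sup>2 y = 0\<close>.

  That \<open>pinv\<close> really satisfies the Penrose conditions is needed for
  \<open>Ft\<close>, \<open>S01\<close> and \<open>M\<close>: Gauss-Jordan elimination provides inner inverses
  \<open>G\<close> of \<open>A\<^sup>T A\<close> and \<open>L\<close> of \<open>A A\<^sup>T\<close>, and \<open>A\<^sup>T L A G A\<^sup>T\<close> is then the
  Moore-Penrose inverse of \<open>A\<close>.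
\<close>

text \<open>Premises on dimensions alone make associativity a rewrite rule for which the simplifier
  need not guess carrier sizes.\<close>

lemma mult_mat_assoc_dim:
  "dim_col A = dim_row B \<Longrightarrow> dim_col B = dim_row C \<Longrightarrow> (A * B) * C = A * (B * C)"
  for A B C :: "'a::semiring_0 mat"
  by (rule assoc_mult_mat[of A "dim_row A" "dim_row B" B "dim_row C" C "dim_col C"]) auto

section \<open>Inner inverses from Gauss-Jordan elimination\<close>

lemma row_echelon_inner_inverse:
  fixes C :: "'a::field mat"
  assumes C: "C \<in> carrier_mat m n" and "row_echelon_form C"
  shows "\<exists>G \<in> carrier_mat n m. C * G * C = C"
proof -
  from assms obtain f where f: "pivot_fun C f n"
    by (auto simp: row_echelon_form_def)
  have dim: "dim_row C = m" using C by simp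
  note p = pivot_funD[OF dim f]
  \<comment> \<open>Column \<open>i\<close> of \<open>G\<close> is the unit vector at the pivot
    column of row \<open>i\<close>. The value \<open>f i = n\<close> marks a zero row of
    \<open>C\<close> and gives a zero column of \<open>G\<close>.\<close>
  define G where "G = mat n m (\<lambda>(j, i). if f i = j then 1 else 0 :: 'a)"
  have G: "G \<in> carrier_mat n m" by (simp add: G_def)
  \<comment> \<open>A pivot equals 1 and is the only nonzero entry of its column, so
    \<open>C * G\<close> is the diagonal 0-1 matrix that selects the nonzero rows of
    \<open>C\<close>.\<close>
  have CG: "(C * G) $$ (k, i) = (if i = k \<and> f i < n then 1 else 0)"
    if k: "k < m" and i: "i < m" for k i
  proof -
    have "(C * G) $$ (k, i) = (\<Sum>j = 0..<n. C $$ (k, j) * (if f i = j then 1 else 0))"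
      using C G k i by (simp add: scalar_prod_def) (simp add: G_def)
    also have "\<dots> = (if f i < n then C $$ (k, f i) else 0)"
      by (simp add: if_distrib[of "(*) _"] cong: if_cong)
    also have "\<dots> = (if i = k \<and> f i < n then 1 else 0)"
      using p(4)[OF i] p(5)[OF i _ k] by auto
    finally show ?thesis .
  qed
  have "(C * G * C) $$ (i, j) = C $$ (i, j)" if i: "i < m" and j: "j < n" for i j
  proof -
    have "(C * G * C) $$ (i, j) = (\<Sum>k = 0..<m. (C * G) $$ (i, k) * C $$ (k, j))"
      using C G i j by (simp add: scalar_prod_def del: assoc_mult_mat)
    also have "\<dots> = (\<Sum>k = 0..<m. if k = i then (if f i < n then C $$ (i, j) else 0) else 0)"
      by (rule sum.cong) (use CG i in auto)
    also have "\<dots> = (if f i < n then C $$ (i, j) else 0)"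
      using i by simp
    also have "\<dots> = C $$ (i, j)"
      using p(1)[OF i] p(2)[OF i] j by (cases "f i < n") auto
    finally show ?thesis .
  qed
  then have "C * G * C = C" using C G by (intro eq_matI) auto
  with G show ?thesis by blast
qed

text \<open>Row reduction multiplies \<open>A\<close> on the left by an invertible \<open>P\<close>.
  If \<open>G\<close> is an inner inverse of \<open>P * A\<close>, then cancelling the outer
  \<open>P\<close> shows that \<open>G * P\<close> is one of \<open>A\<close>.\<close>

lemma inner_inverse_exists:
  fixes A :: "'a::field mat"
  assumes A: "A \<in> carrier_mat m n"
  shows "\<exists>G \<in> carrier_mat n m. A * G * A = A"
proof -
  note gj = gauss_jordan_single[OF A refl]
  from gj(4) obtain P Q where C: "gauss_jordan_single A = P * A"
    and P: "P \<in> carrier_mat m m" and Q: "Q \<in> carrier_mat m m" and QP: "Q * P = 1\<^sub>m m"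
    by blast
  from row_echelon_inner_inverse[OF gj(2,3)] obtain G
    where G: "G \<in> carrier_mat n m" and GC: "P * A * G * (P * A) = P * A"
    unfolding C by blast
  have QPA: "Q * (P * A) = A"
    using assoc_mult_mat[OF Q P A] QP A by simp
  have "A * (G * P) * A = Q * (P * A) * (G * P) * A" by (simp add: QPA)
  also have "\<dots> = Q * (P * A * G * (P * A))"
    using A P Q G by (simp add: mult_mat_assoc_dim)
  also have "\<dots> = A" by (simp add: GC QPA)
  finally have "A * (G * P) * A = A" .
  with G P show ?thesis by (intro bexI[of _ "G * P"]) auto
qed

section \<open>Gram matrices and orthogonal range projectors\<close>

lemma gram_mat_eq_0:
  fixes A :: "real mat"
  assumes A: "A \<in> carrier_mat m n" and z: "transpose_mat A * A = 0\<^sub>m n n"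
  shows "A = 0\<^sub>m m n"
proof (rule eq_matI)
  fix i j assume "i < dim_row (0\<^sub>m m n :: real mat)" "j < dim_col (0\<^sub>m m n :: real mat)"
  then have ij: "i < m" "j < n" by auto
  \<comment> \<open>A diagonal entry of the Gram matrix is the sum of the squares of a column, so
    over the reals it vanishes only with the whole column.\<close>
  have "(\<Sum>k = 0..<m. A $$ (k, j) * A $$ (k, j)) = (transpose_mat A * A) $$ (j, j)"
    using A ij by (simp add: scalar_prod_def)
  also have "\<dots> = 0" using z ij by simp
  finally show "A $$ (i, j) = 0\<^sub>m m n $$ (i, j)"
    using ij by (simp add: sum_nonneg_eq_0_iff)
qed (use A in auto)

text \<open>Let \<open>E\<close> be the difference of the two sides and \<open>T\<close> the
  transpose of \<open>A\<close>. The premise gives \<open>T * E = 0\<close>, and the transpose of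
  \<open>E\<close> has \<open>T\<close> as a right factor, so the Gram matrix of \<open>E\<close> is
  zero and hence \<open>E\<close> is.\<close>

lemma gram_inner_inverse_cancel:
  fixes A :: "real mat"
  assumes A: "A \<in> carrier_mat m n" and G: "G \<in> carrier_mat n n"
    and H: "transpose_mat A * A * G * (transpose_mat A * A) = transpose_mat A * A"
  shows "A * G * transpose_mat A * A = A"
proof -
  define T where "T = transpose_mat A"
  have T: "T \<in> carrier_mat n m" using A by (simp add: T_def)
  define Q where "Q = A * G * T"
  have Q: "Q \<in> carrier_mat m m" using A G T by (simp add: Q_def)
  define E where "E = Q * A - A"
  have E: "E \<in> carrier_mat m n" using A by (simp add: E_def minus_carrier_mat)
  have "T * E = T * (Q * A) - T * A"
    unfolding E_def using A Q T by (intro mult_minus_distrib_mat) auto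
  also have "T * (Q * A) = T * A"
    using H A G T by (simp add: Q_def mult_mat_assoc_dim flip: T_def)
  also have "T * A - T * A = 0\<^sub>m n n" using A T by auto
  finally have TE: "T * E = 0\<^sub>m n n" .
  have "transpose_mat E = transpose_mat (Q * A) - T"
    using A Q by (simp add: E_def T_def transpose_minus[of _ m n])
  also have "transpose_mat (Q * A) = T * transpose_mat Q"
    using A Q by (simp add: T_def transpose_mult)
  also have "transpose_mat Q = A * (transpose_mat G * T)"
    using A G T transpose_mult[of A m n "G * T" m] transpose_mult[of G n n T m]
    by (simp add: Q_def T_def mult_mat_assoc_dim)
  finally have "transpose_mat E * E = T * (A * (transpose_mat G * T)) * E - T * E"
    using A G T E by (simp add: minus_mult_distrib_mat[of _ n m])
  also have "\<dots> = T * A * transpose_mat G * (T * E) - T * E"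
    using A G T E by (simp add: mult_mat_assoc_dim)
  also have "\<dots> = 0\<^sub>m n n"
    using A G T by (simp add: TE)
  finally have E0: "E = 0\<^sub>m m n" by (rule gram_mat_eq_0[OF E])
  have "A * G * T * A = E + A"
    using A Q by (intro eq_matI) (auto simp: E_def Q_def simp del: index_mult_mat(1))
  then show ?thesis using A by (simp add: E0 T_def)
qed

text \<open>An inner inverse \<open>G\<close> of the Gram matrix may fail to be symmetric, but its
  transpose is again an inner inverse. Hence \<open>Q = A * G * transpose_mat A\<close> and its
  transpose both fix \<open>A\<close>, which gives \<open>transpose_mat Q * Q = Q\<close>; the left
  side is symmetric.\<close>

lemma range_projector:
  fixes A :: "real mat"
  assumes A: "A \<in> carrier_mat m n"
  shows "\<exists>G \<in> carrier_mat n n. transpose_mat (A * G * transpose_mat A) = A * G * transpose_mat A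
           \<and> A * G * transpose_mat A * A = A"
proof -
  define T H where "T = transpose_mat A" and "H = T * A"
  have T: "T \<in> carrier_mat n m" and H: "H \<in> carrier_mat n n"
    using A by (simp_all add: T_def H_def)
  from inner_inverse_exists[OF H] obtain G where G: "G \<in> carrier_mat n n"
    and HGH: "H * G * H = H"
    by blast
  have "transpose_mat H = H"
    using transpose_mult[OF T A] by (simp add: H_def T_def)
  then have "H * transpose_mat G * H = transpose_mat (H * G * H)"
    using H G by (simp add: transpose_mult[of _ n n _ n] mult_mat_assoc_dim)
  then have HGH': "H * transpose_mat G * H = H" by (simp add: HGH \<open>transpose_mat H = H\<close>)
  define Q where "Q = A * G * T"
  have Q: "Q \<in> carrier_mat m m" using A G T by (simp add: Q_def)
  have QA: "Q * A = A"
    using gram_inner_inverse_cancel[OF A G] HGH by (simp add: Q_def H_def T_def)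
  have Qt: "transpose_mat Q = A * transpose_mat G * T"
    using A G T transpose_mult[of A m n "G * T" m] transpose_mult[of G n n T m]
    by (simp add: Q_def T_def mult_mat_assoc_dim)
  have "transpose_mat Q * A = A"
    using gram_inner_inverse_cancel[OF A, of "transpose_mat G"] G HGH'
    by (simp add: Qt H_def T_def)
  then have "transpose_mat Q * Q = Q"
    using A G T Q assoc_mult_mat[of "transpose_mat Q" m m A n "G * T" m]
    by (simp add: Q_def mult_mat_assoc_dim)
  then have "transpose_mat Q = Q"
    using transpose_mult[of "transpose_mat Q" m m Q m] Q by simp
  with QA G show ?thesis unfolding Q_def T_def by blast
qed

section \<open>Existence of the Moore-Penrose inverse and its null-space projector\<close>

lemma is_pinv_pinv: "is_pinv A (pinv A)"
proof -
  define m n T where "m = dim_row A" and "n = dim_col A" and "T = transpose_mat A"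
  have A: "A \<in> carrier_mat m n" and T: "T \<in> carrier_mat n m"
    by (simp_all add: m_def n_def T_def)
  from range_projector[OF A] obtain G where G: "G \<in> carrier_mat n n"
    and Gs: "transpose_mat (A * G * T) = A * G * T" and GA: "A * G * T * A = A"
    unfolding T_def by blast
  \<comment> \<open>Applied to the transpose, the construction gives the orthogonal projector
    \<open>T * L * A\<close> onto the row space of \<open>A\<close>.\<close>
  from range_projector[OF T] obtain L where L: "L \<in> carrier_mat m m"
    and Ls: "transpose_mat (T * L * A) = T * L * A" and LT: "T * L * A * T = T"
    unfolding T_def by auto
  have "transpose_mat (T * L * A * T) = A * (T * L * A)"
    using transpose_mult[of "T * L * A" n n T m] A L T Ls by (simp add: T_def)
  then have LA: "A * (T * L * A) = A"
    unfolding LT by (simp add: T_def)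
  have d: "dim_row A = m" "dim_col A = n" "dim_row T = n" "dim_col T = m"
    "dim_row G = n" "dim_col G = n" "dim_row L = m" "dim_col L = m"
    using A T G L by auto
  \<comment> \<open>With this \<open>B\<close>, the product \<open>A * B\<close> collapses to the
    projector onto the column space and \<open>B * A\<close> to the one onto the row space, so both
    are symmetric.\<close>
  define B where "B = T * L * A * G * T"
  have AB: "A * B = A * G * T"
  proof -
    have "A * B = A * (T * L * A) * G * T" by (simp add: B_def mult_mat_assoc_dim d)
    then show ?thesis by (simp add: LA)
  qed
  have BA: "B * A = T * L * A"
  proof -
    have "B * A = T * L * (A * G * T * A)" by (simp add: B_def mult_mat_assoc_dim d)
    then show ?thesis by (simp add: GA)
  qed
  have "B * A * B = T * L * A * T * L * A * G * T"
    by (simp add: BA) (simp add: B_def mult_mat_assoc_dim d)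
  then have "B * A * B = B" by (simp add: LT B_def)
  then have "is_pinv A B"
    unfolding is_pinv_def AB BA using Gs GA Ls by (auto simp: B_def d)
  then show ?thesis using pinv_eqI by metis
qed

lemma mult_null_projector:
  assumes A: "A \<in> carrier_mat m n"
  shows "A * (1\<^sub>m n - pinv A * A) = 0\<^sub>m m n"
proof -
  have B: "pinv A \<in> carrier_mat n m" and p: "A * pinv A * A = A"
    using is_pinv_pinv[of A] A by (auto simp: is_pinv_def)
  have "A * (1\<^sub>m n - pinv A * A) = A * 1\<^sub>m n - A * (pinv A * A)"
    using A B by (intro mult_minus_distrib_mat) auto
  also have "A * (pinv A * A) = A"
    using assoc_mult_mat[OF A B A] p by simp
  finally show ?thesis using A by simp
qed

lemma null_projector_fixes_kernel:
  assumes A: "A \<in> carrier_mat m n" and z: "z \<in> carrier_vec n" and "A *\<^sub>v z = 0\<^sub>v m"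
  shows "(1\<^sub>m n - pinv A * A) *\<^sub>v z = z"
proof -
  have B: "pinv A \<in> carrier_mat n m"
    using is_pinv_pinv[of A] A by (auto simp: is_pinv_def)
  have "(1\<^sub>m n - pinv A * A) *\<^sub>v z = z - pinv A *\<^sub>v (A *\<^sub>v z)"
    using A B z by (simp add: minus_mult_distrib_mat_vec[of _ n n])
  also have "pinv A *\<^sub>v (A *\<^sub>v z) = 0\<^sub>v n"
    using B assms by (intro eq_vecI) auto
  finally show ?thesis using z by simp
qed

section \<open>The null space in singular-vector coordinates\<close>

lemma mult_mat_zero_vec: "A \<in> carrier_mat m n \<Longrightarrow> A *\<^sub>v 0\<^sub>v n = (0\<^sub>v m :: 'a::semiring_0 vec)"
  by (intro eq_vecI) auto

lemma zero_mat_mult_vec: "v \<in> carrier_vec n \<Longrightarrow> 0\<^sub>m m n *\<^sub>v v = (0\<^sub>v m :: 'a::semiring_0 vec)"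
  by (intro eq_vecI) auto

text \<open>\<open>U\<close> is injective because its transpose is a left inverse, and the diagonal
  block \<open>D\<close> is injective because its diagonal is positive. The zero blocks discard the
  last \<open>n - r\<close> coordinates.\<close>

lemma is_svd_kernel_iff:
  assumes svd: "is_svd n r A U D V" and y: "y \<in> carrier_vec n"
  shows "A *\<^sub>v y = 0\<^sub>v n \<longleftrightarrow> vec_first (transpose_mat V *\<^sub>v y) r = 0\<^sub>v r"
proof -
  define S where
    "S = four_block_mat D (0\<^sub>m r (n - r)) (0\<^sub>m (n - r) r) (0\<^sub>m (n - r) (n - r))"
  from svd have rn: "r \<le> n" and U: "U \<in> carrier_mat n n" and UU: "transpose_mat U * U = 1\<^sub>m n"
    and V: "V \<in> carrier_mat n n" and D: "D \<in> carrier_mat r r" and diag: "diagonal_mat D"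
    and pos: "\<And>i. i < r \<Longrightarrow> 0 < D $$ (i, i)" and Aeq: "A = U * S * transpose_mat V"
    by (auto simp: is_svd_def orthonormal_mat_def S_def)
  have S: "S \<in> carrier_mat n n"
    using D rn unfolding S_def by (metis four_block_carrier_mat le_add_diff_inverse zero_carrier_mat)
  define w a b where "w = transpose_mat V *\<^sub>v y" and "a = vec_first w r" and "b = vec_last w (n - r)"
  have w: "w \<in> carrier_vec n" using V y by (simp add: w_def)
  have a: "a \<in> carrier_vec r" and b: "b \<in> carrier_vec (n - r)"
    by (simp_all add: a_def b_def)
  have wab: "w = a @\<^sub>v b"
    using w rn by (simp add: a_def b_def)
  have Ay: "A *\<^sub>v y = U *\<^sub>v (S *\<^sub>v w)"
    using U S V y by (simp add: Aeq w_def assoc_mult_mat_vec[of _ n n _ n])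
  have "S *\<^sub>v w = (D *\<^sub>v a) @\<^sub>v (0\<^sub>m (n - r) (n - r) *\<^sub>v b)"
    unfolding S_def wab using D a b by (intro mult_mat_vec_split) auto
  also have "0\<^sub>m (n - r) (n - r) *\<^sub>v b = 0\<^sub>v (n - r)"
    by (rule zero_mat_mult_vec[OF b])
  finally have "S *\<^sub>v w = (D *\<^sub>v a) @\<^sub>v 0\<^sub>v (n - r)" .
  moreover have "0\<^sub>v n = 0\<^sub>v r @\<^sub>v (0\<^sub>v (n - r) :: real vec)"
    using rn by (intro eq_vecI) auto
  ultimately have Sw: "S *\<^sub>v w = 0\<^sub>v n \<longleftrightarrow> D *\<^sub>v a = 0\<^sub>v r"
    using D a by (simp add: append_vec_eq[of _ r])
  have "U *\<^sub>v u = 0\<^sub>v n \<longleftrightarrow> u = 0\<^sub>v n" if u: "u \<in> carrier_vec n" for u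
  proof
    assume "U *\<^sub>v u = 0\<^sub>v n"
    then have "transpose_mat U * U *\<^sub>v u = transpose_mat U *\<^sub>v 0\<^sub>v n"
      using U u by simp
    then show "u = 0\<^sub>v n" using U UU u by (simp add: mult_mat_zero_vec[of _ n n])
  qed (use U in \<open>simp add: mult_mat_zero_vec\<close>)
  moreover have "S *\<^sub>v w \<in> carrier_vec n" using S w by simp
  moreover have "D *\<^sub>v a = 0\<^sub>v r \<longleftrightarrow> a = 0\<^sub>v r"
  proof
    assume Da: "D *\<^sub>v a = 0\<^sub>v r"
    have "a $ i = 0" if i: "i < r" for i
    proof -
      have "(D *\<^sub>v a) $ i = (\<Sum>j = 0..<r. D $$ (i, j) * a $ j)"
        using D a i by (simp add: scalar_prod_def)
      also have "\<dots> = (\<Sum>j = 0..<r. if j = i then D $$ (i, i) * a $ i else 0)"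
        using diag D i by (intro sum.cong) (auto simp: diagonal_mat_def)
      finally have "D $$ (i, i) * a $ i = 0" using Da i by simp
      then show ?thesis using pos[OF i] by simp
    qed
    then show "a = 0\<^sub>v r" using a by (intro eq_vecI) auto
  qed (use D in \<open>simp add: mult_mat_zero_vec\<close>)
  ultimately show ?thesis
    using Ay Sw by (simp add: a_def w_def)
qed

lemma svd_kernel_second_iterate:
  assumes svd: "is_svd n r A U D V"
    and F: "F \<in> carrier_mat n n"
    and S: "S00 \<in> carrier_mat r r" "S01 \<in> carrier_mat r (n - r)"
      "S10 \<in> carrier_mat (n - r) r" "S11 \<in> carrier_mat (n - r) (n - r)"
    and blocks: "transpose_mat V * F * V = four_block_mat S00 S01 S10 S11"
    and cond: "S01 * S11 * (1\<^sub>m (n - r) - pinv S01 * S01) = 0\<^sub>m r (n - r)"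
    and y: "y \<in> carrier_vec n"
    and 0: "A *\<^sub>v y = 0\<^sub>v n" and 1: "A *\<^sub>v (F *\<^sub>v y) = 0\<^sub>v n"
  shows "A *\<^sub>v (F *\<^sub>v (F *\<^sub>v y)) = 0\<^sub>v n"
proof -
  from svd have rn: "r \<le> n" and V: "V \<in> carrier_mat n n"
    and VV: "V * transpose_mat V = 1\<^sub>m n"
    by (auto simp: is_svd_def orthonormal_mat_def)
  \<comment> \<open>One application of \<open>F\<close> in the coordinates of \<open>V\<close>, kept
    general in \<open>u\<close> and \<open>z\<close> because it is used for \<open>y\<close> and
    again for \<open>F *\<^sub>v y\<close>.\<close>
  have step: "transpose_mat V *\<^sub>v (F *\<^sub>v u) = (S01 *\<^sub>v z) @\<^sub>v (S11 *\<^sub>v z)"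
    if u: "u \<in> carrier_vec n" and z: "z \<in> carrier_vec (n - r)"
      and uz: "transpose_mat V *\<^sub>v u = 0\<^sub>v r @\<^sub>v z" for u z
  proof -
    have "V *\<^sub>v (transpose_mat V *\<^sub>v u) = u"
      using assoc_mult_mat_vec[of V n n "transpose_mat V" n u] V VV u by simp
    then have "transpose_mat V *\<^sub>v (F *\<^sub>v u)
        = transpose_mat V * F * V *\<^sub>v (transpose_mat V *\<^sub>v u)"
      using V F u by (simp add: assoc_mult_mat_vec[of _ n n _ n] del: assoc_mult_mat)
    also have "\<dots> = (S00 *\<^sub>v 0\<^sub>v r + S01 *\<^sub>v z) @\<^sub>v (S10 *\<^sub>v 0\<^sub>v r + S11 *\<^sub>v z)"
      unfolding blocks uz using S z by (intro four_block_mat_mult_vec) auto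
    also have "\<dots> = (S01 *\<^sub>v z) @\<^sub>v (S11 *\<^sub>v z)"
      using S z by (simp add: mult_mat_zero_vec)
    finally show ?thesis .
  qed
  have first: "vec_first (a @\<^sub>v b) r = a" if "a \<in> carrier_vec r" for a b :: "real vec"
    using that by (intro eq_vecI) (auto simp: vec_first_def)
  define z where "z = vec_last (transpose_mat V *\<^sub>v y) (n - r)"
  have z: "z \<in> carrier_vec (n - r)" by (simp add: z_def)
  have yz: "transpose_mat V *\<^sub>v y = 0\<^sub>v r @\<^sub>v z"
    using is_svd_kernel_iff[OF svd y] 0 V y rn vec_first_last_append[of "transpose_mat V *\<^sub>v y" r "n - r"]
    by (simp add: z_def)
  note Fy = step[OF y z yz]
  have Fyc: "F *\<^sub>v y \<in> carrier_vec n" using F y by simp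
  have z0: "S01 *\<^sub>v z = 0\<^sub>v r"
    using is_svd_kernel_iff[OF svd Fyc] 1 S z by (simp add: Fy first)
  \<comment> \<open>Since \<open>S01\<close> annihilates \<open>z\<close>, the projector in
    \<open>cond\<close> fixes \<open>z\<close> and may be inserted in front of it.\<close>
  have "S01 *\<^sub>v (S11 *\<^sub>v z) = S01 * S11 *\<^sub>v ((1\<^sub>m (n - r) - pinv S01 * S01) *\<^sub>v z)"
    using null_projector_fixes_kernel[OF S(2) z z0] S z by simp
  also have "\<dots> = S01 * S11 * (1\<^sub>m (n - r) - pinv S01 * S01) *\<^sub>v z"
    using S z is_pinv_pinv[of S01]
    by (intro assoc_mult_mat_vec[symmetric, of _ r "n - r" _ "n - r"]) (auto simp: is_pinv_def)
  also have "\<dots> = 0\<^sub>v r" using z by (simp add: cond zero_mat_mult_vec)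
  finally have z1: "S01 *\<^sub>v (S11 *\<^sub>v z) = 0\<^sub>v r" .
  \<comment> \<open>By \<open>z0\<close> the coordinates of \<open>F *\<^sub>v y\<close> again have
    zero upper part, so \<open>step\<close> applies with \<open>S11 *\<^sub>v z\<close> in place of
    \<open>z\<close>.\<close>
  have "transpose_mat V *\<^sub>v (F *\<^sub>v (F *\<^sub>v y)) = (S01 *\<^sub>v (S11 *\<^sub>v z)) @\<^sub>v (S11 *\<^sub>v (S11 *\<^sub>v z))"
    using Fyc Fy S z z0 by (intro step) auto
  then show ?thesis
    using is_svd_kernel_iff[OF svd, of "F *\<^sub>v (F *\<^sub>v y)"] F Fyc by (simp add: first z1)
qed

section \<open>Elimination of the decision weights\<close>

lemma Ftilde2_eq:
  assumes F0: "F0 \<in> carrier_mat n n"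
    and Ft: "Ft = F1 - F0" and P: "P = 1\<^sub>m n - pinv Ft * Ft" and M: "M = Ft * F0 * P"
  shows "Ftilde2 F0 F1 = Ft * F0 * F0 * P * (1\<^sub>m n - pinv M * M)"
proof -
  have cFt: "Ft \<in> carrier_mat n n" using F0 Ft by (simp add: minus_carrier_mat)
  have cG: "pinv Ft \<in> carrier_mat n n"
    using is_pinv_pinv[of Ft] cFt by (simp add: is_pinv_def)
  have cP: "P \<in> carrier_mat n n" using P cFt cG by (simp add: minus_carrier_mat)
  have cM: "M \<in> carrier_mat n n" using M cFt F0 cP by simp
  have cN: "pinv M \<in> carrier_mat n n"
    using is_pinv_pinv[of M] cM by (simp add: is_pinv_def)
  have np: "null_proj Ft = P" using cFt by (simp add: null_proj_def P)
  define K where "K = Ft * (F0 * F0)"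
  define w where "w = weight1 Ft F0"
  have cK: "K \<in> carrier_mat n n" using cFt F0 by (simp add: K_def)
  have w: "w = - (K * P * pinv M)"
    by (simp add: w_def weight1_def np K_def flip: M)
  have cw: "w \<in> carrier_mat n n" using w cK cP cN by simp
  \<comment> \<open>\<open>R\<close> collects the terms free of the second weight, and that weight
    is exactly \<open>- (R * pinv Ft)\<close>.\<close>
  define R where "R = w * Ft * F0 + K"
  have cR: "R \<in> carrier_mat n n" using cw cFt F0 cK by (simp add: R_def)
  have R: "(w * Ft + Ft * F0) * F0 = R"
    using cw cFt F0 by (simp add: R_def K_def add_mult_distrib_mat[of _ n n] mult_mat_assoc_dim)
  have RP: "R * P = R - R * (pinv Ft * Ft)"
    unfolding P using cR cG cFt by (subst mult_minus_distrib_mat) auto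
  have "Ftilde2 F0 F1 = - (R * pinv Ft) * Ft + w * Ft * F0 + K"
    by (simp add: Ftilde2_def transition_diff2_def weight2_def Let_def R K_def flip: Ft w_def)
  \<comment> \<open>The second weight removes from \<open>R\<close> its part
    \<open>R * (pinv Ft * Ft)\<close> on the row space of \<open>Ft\<close>.\<close>
  also have "\<dots> = R * P"
  proof -
    have "- (R * pinv Ft) * Ft = - (R * (pinv Ft * Ft))"
      using cR cG cFt by (simp add: mult_mat_assoc_dim)
    then show ?thesis
      unfolding RP using cR cG cFt cw cK F0
      by (intro eq_matI) (auto simp: R_def simp del: index_mult_mat(1))
  qed
  \<comment> \<open>The first weight repeats this cancellation one date earlier:
    \<open>w * M\<close> removes from \<open>K * P\<close> its part on the row space of
    \<open>M\<close>.\<close>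
  also have "\<dots> = w * M + K * P"
    using cw cFt F0 cK cP by (simp add: R_def M add_mult_distrib_mat[of _ n n] mult_mat_assoc_dim)
  also have "w * M = - (K * P * (pinv M * M))"
    using cK cP cN cM by (simp add: w mult_mat_assoc_dim)
  also have "- (K * P * (pinv M * M)) + K * P = K * P * (1\<^sub>m n - pinv M * M)"
  proof -
    have "K * P * (1\<^sub>m n - pinv M * M) = K * P * 1\<^sub>m n - K * P * (pinv M * M)"
      using cK cP cN cM by (intro mult_minus_distrib_mat) auto
    also have "K * P * 1\<^sub>m n = K * P" using cK cP by simp
    finally show ?thesis
      using cK cP cN cM by (intro eq_matI) (auto simp del: index_mult_mat(1))
  qed
  finally show ?thesis
    using cFt F0 by (simp add: K_def mult_mat_assoc_dim)
qed

section \<open>Finite dependence, column by column\<close>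

theorem proposition3:
  fixes X r :: nat
    and F0 F1 Ft U V D S00 S01 S10 S11 P M :: "real mat"
  assumes "X \<ge> 1"
    and "markov_mat X F0" and "markov_mat X F1"
    and "Ft = F1 - F0"
    and "r = vec_space.rank X Ft"
    and "is_svd X r Ft U D V"
    and "S00 \<in> carrier_mat r r" and "S01 \<in> carrier_mat r (X - r)"
    and "S10 \<in> carrier_mat (X - r) r" and "S11 \<in> carrier_mat (X - r) (X - r)"
    and "transpose_mat V * F0 * V = four_block_mat S00 S01 S10 S11"
    and "S01 * S11 * (1\<^sub>m (X - r) - pinv S01 * S01) = 0\<^sub>m r (X - r)"
    and "P = 1\<^sub>m X - pinv Ft * Ft"
    and "M = Ft * F0 * P"
  shows "two_period_finite_dependence X F0 F1
       \<and> Ftilde2 F0 F1 = Ft * F0 * F0 * P * (1\<^sub>m X - pinv M * M)"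
proof -
  have F0: "F0 \<in> carrier_mat X X"
    using assms(2) by (simp add: markov_mat_def)
  have Ft: "Ft \<in> carrier_mat X X" using F0 assms(4) by (simp add: minus_carrier_mat)
  have "pinv Ft \<in> carrier_mat X X"
    using is_pinv_pinv[of Ft] Ft by (simp add: is_pinv_def)
  then have P: "P \<in> carrier_mat X X" using Ft assms(13) by (simp add: minus_carrier_mat)
  have M: "M \<in> carrier_mat X X" using Ft F0 P assms(14) by simp
  define E where "E = 1\<^sub>m X - pinv M * M"
  have E: "E \<in> carrier_mat X X"
    using is_pinv_pinv[of M] M by (auto simp: is_pinv_def E_def)
  note eq = Ftilde2_eq[OF F0 assms(4,13,14)]
  define Y where "Y = P * E"
  have Y: "Y \<in> carrier_mat X X" using P E by (simp add: Y_def)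
  have "Ft * P = 0\<^sub>m X X"
    unfolding assms(13) by (rule mult_null_projector[OF Ft])
  then have FtY: "Ft * Y = 0\<^sub>m X X"
    using assoc_mult_mat[OF Ft P E] E by (simp add: Y_def)
  \<comment> \<open>As \<open>M = Ft * F0 * P\<close> and \<open>Y = P * E\<close>, this is the
    second kernel equation for the columns of \<open>Y\<close>.\<close>
  have "M * E = 0\<^sub>m X X"
    unfolding E_def by (rule mult_null_projector[OF M])
  then have FtF0Y: "Ft * (F0 * Y) = 0\<^sub>m X X"
    using Ft F0 P E by (simp add: Y_def assms(14) mult_mat_assoc_dim)
  have "Ft * (F0 * (F0 * Y)) = 0\<^sub>m X X"
  proof (rule mat_col_eqI)
    fix j assume "j < dim_col (0\<^sub>m X X :: real mat)"
    then have j: "j < X" by simp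
    \<comment> \<open>Passes from a product of matrices to its action on a column, one factor at a
      time, where the kernel lemma for vectors applies.\<close>
    have c: "A * B \<in> carrier_mat X X \<and> col (A * B) j = A *\<^sub>v col B j"
      if "A \<in> carrier_mat X X" "B \<in> carrier_mat X X" for A B :: "real mat"
      using that j by auto
    have "Ft *\<^sub>v (F0 *\<^sub>v (F0 *\<^sub>v col Y j)) = 0\<^sub>v X"
    proof (rule svd_kernel_second_iterate[OF assms(6) F0 assms(7-12)])
      show "col Y j \<in> carrier_vec X" using Y by (metis col_dim carrier_matD(1))
      show "Ft *\<^sub>v col Y j = 0\<^sub>v X" using c[OF Ft Y] FtY j by simp
      show "Ft *\<^sub>v (F0 *\<^sub>v col Y j) = 0\<^sub>v X"
        using c[OF F0 Y] c[OF Ft, of "F0 * Y"] FtF0Y j by simp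
    qed
    then show "col (Ft * (F0 * (F0 * Y))) j = col (0\<^sub>m X X) j"
      using c[OF F0 Y] c[OF F0, of "F0 * Y"] c[OF Ft, of "F0 * (F0 * Y)"] j by simp
  qed (use Ft Y in auto)
  then have "Ft * F0 * F0 * P * E = 0\<^sub>m X X"
    using Ft F0 P E by (simp add: Y_def mult_mat_assoc_dim)
  then show ?thesis
    using eq by (simp add: two_period_finite_dependence_def E_def)
qed

end
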